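(* Let $p:\mathbb{R}\to[0,\infty)$ be a probability density function with support $\mathbb{R}$ and distribution function $P$, satisfying the following conditions. (i) $p$ is continuous and positive on $\mathbb{R}$, and there are finitely many points $-\infty<y_1<\dots<y_m<\infty$ ($m\ge 0$) such that $p$ is continuously differentiable on each component interval of $S(p)=\mathbb{R}\setminus\{y_1,\dots,y_m\}$. (ii) $\sup_{x\in S(p)}\left|\frac{p'(x)\min\{P(x),1-P(x)\}}{p^2(x)}\right|<\infty$. (iii) $\int_{S(p)}(1+|x|)\,|p'(x)|\,\mathrm{d}x<\infty$. Let $X:\Omega\to\mathbb{R}$ be a random variable with $\mathbb{P}(X\in S(p))=1$, $\mathbb{E}\left|\frac{p'(X)}{p(X)}\right|<\infty$ and $\mathbb{E}\left|\frac{p'(X)}{p(X)}X\right|<\infty$. Then $X$ has Lebesgue density $p$ if, and only if, the distribution function $F_X$ of $X$ has the form $$F_X(t)=\mathbb{E}\left[\frac{p'(X)}{p(X)}\,(t-X)\,\mathbf{1}\{X\le t\}\right],\quad t\in\mathbb{R}.$$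
   Context: $(\Omega,\mathcal{A},\mathbb{P})$ is a probability space. $F_X(t)=\mathbb{P}(X\le t)$ is the distribution function of $X$, and $\mathbf{1}\{\cdot\}$ denotes an indicator. "$X$ has Lebesgue density $p$" means that the law of $X$ is $p\,\mathcal{L}^1$, where $\mathcal{L}^1$ is Lebesgue measure on $\mathbb{R}$. $P(x)=\int_{-\infty}^x p(s)\,\mathrm{d}s$. The case $m=0$ (no exceptional points, $S(p)=\mathbb{R}$) is allowed. *)

theory Defs
  imports "HOL-Probability.Probability"
begin

end

theory Submission
  imports Defs
begin

text \<open>
  Write \<open>\<rho> = p' / p\<close>, \<open>F\<close> for the distribution function of \<open>X\<close>, and put
  \<open>K t = E [\<rho>(X) (t - X) 1{X \<le> t}]\<close> and \<open>f t = E [\<rho>(X) 1{X \<le> t}]\<close>; all of \<open>F\<close>, \<open>K\<close> and \<open>f\<close>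
  tend to 0 at \<open>-\<infinity>\<close>. Everything follows from two derivatives. Formally differentiating under the
  expectation gives \<open>K' = f\<close>, which is valid wherever \<open>X\<close> has no atom
  (\<open>weighted_ramp_has_derivative\<close>). And \<open>f' = \<rho> F'\<close> wherever \<open>\<rho>\<close> is continuous and \<open>F\<close> is
  differentiable (\<open>weighted_cdf_has_derivative\<close>), because \<open>\<rho>(X)\<close> is almost constant on the event
  that \<open>X\<close> lies in a short interval. Let \<open>P\<close> be the distribution function with density \<open>p\<close>, so
  that \<open>P' = p\<close>.

  If \<open>F = P\<close>, then \<open>f' = \<rho> p = p'\<close> off the finite exceptional set, so \<open>f - p\<close> is a constant by
  continuity. Thus \<open>p\<close> has a limit at \<open>-\<infinity>\<close>; being the derivative of a function that has a limit there,
  it tends to 0, and so \<open>f = p\<close>. Now \<open>K' = f = p = F'\<close> and \<open>K\<close>, \<open>F\<close> have the same limit at \<open>-\<infinity>\<close>, so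
  \<open>F = K\<close>.

  If \<open>F = K\<close>, then \<open>F\<close> is Lipschitz since \<open>K\<close> is. Hence \<open>X\<close> has no atoms, \<open>F' = K' = f\<close> everywhere,
  and off the exceptional set \<open>f\<close> solves the linear equation \<open>f' = \<rho> f\<close>, which \<open>p\<close> solves too.
  Therefore \<open>f / p\<close> is a constant \<open>c\<close>, by continuity even across the exceptional points. Comparing
  derivatives and limits at \<open>-\<infinity>\<close> gives \<open>F = c P\<close>, and the limits at \<open>\<infinity>\<close> give \<open>c = 1\<close>.
\<close>

section \<open>Truncated expectations of a weighted random variable\<close>

locale weighted_random_variable = prob_space M for M :: "'a measure" +
  fixes X w :: "'a \<Rightarrow> real"
  assumes X_meas [measurable]: "X \<in> borel_measurable M"
    and w_integrable: "integrable M w"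
    and wX_integrable: "integrable M (\<lambda>\<omega>. w \<omega> * X \<omega>)"
begin

definition weighted_cdf :: "real \<Rightarrow> real" where
  "weighted_cdf t = (\<integral>\<omega>. w \<omega> * indicator {\<omega>. X \<omega> \<le> t} \<omega> \<partial>M)"

definition weighted_ramp :: "real \<Rightarrow> real" where
  "weighted_ramp t = (\<integral>\<omega>. w \<omega> * (t - X \<omega>) * indicator {\<omega>. X \<omega> \<le> t} \<omega> \<partial>M)"

lemma w_meas [measurable]: "w \<in> borel_measurable M"
  using w_integrable by auto

lemma weighted_ramp_eq_max: "weighted_ramp t = (\<integral>\<omega>. w \<omega> * max 0 (t - X \<omega>) \<partial>M)"
  unfolding weighted_ramp_def
  by (intro Bochner_Integration.integral_cong) (auto simp: indicator_def max_def)

lemma indicator_le_integrable: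
  assumes "integrable M g"
  shows "integrable M (\<lambda>\<omega>. g \<omega> * indicator {\<omega>. X \<omega> \<le> t} \<omega> :: real)"
proof (rule Bochner_Integration.integrable_bound[OF assms])
  show "(\<lambda>\<omega>. g \<omega> * indicator {\<omega>. X \<omega> \<le> t} \<omega>) \<in> borel_measurable M"
  proof -
    have [measurable]: "g \<in> borel_measurable M" using assms by auto
    have "(\<lambda>\<omega>. g \<omega> * (if X \<omega> \<le> t then 1 else 0)) \<in> borel_measurable M"
      by measurable
    also have "(\<lambda>\<omega>. g \<omega> * (if X \<omega> \<le> t then 1 else 0))
        = (\<lambda>\<omega>. g \<omega> * indicator {\<omega>. X \<omega> \<le> t} \<omega>)"
      by (auto simp: indicator_def)
    finally show ?thesis .
  qed
qed (auto simp: indicator_def)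

lemma max_integrable: "integrable M (\<lambda>\<omega>. w \<omega> * max 0 (t - X \<omega>))"
proof -
  have "integrable M (\<lambda>\<omega>. t * w \<omega> - w \<omega> * X \<omega>)"
    using w_integrable wX_integrable by auto
  from this show ?thesis
    by (rule Bochner_Integration.integrable_bound)
       (auto simp: max_def abs_mult algebra_simps abs_minus_commute)
qed

text \<open>The bound is inherited from \<open>u \<mapsto> max 0 u\<close>, which is 1-Lipschitz. Its use is that a distribution
  function equal to the ramp is continuous, so that \<open>X\<close> has no atoms.\<close>

lemma weighted_ramp_Lipschitz:
  "\<bar>weighted_ramp s - weighted_ramp t\<bar> \<le> (\<integral>\<omega>. \<bar>w \<omega>\<bar> \<partial>M) * \<bar>s - t\<bar>"
proof -
  have "weighted_ramp s - weighted_ramp t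
      = (\<integral>\<omega>. w \<omega> * max 0 (s - X \<omega>) - w \<omega> * max 0 (t - X \<omega>) \<partial>M)"
    unfolding weighted_ramp_eq_max
    by (rule Bochner_Integration.integral_diff[symmetric]) (rule max_integrable)+
  also have "\<bar>\<dots>\<bar> \<le> (\<integral>\<omega>. \<bar>w \<omega>\<bar> * \<bar>s - t\<bar> \<partial>M)"
  proof (rule order_trans[OF integral_abs_bound], rule integral_mono)
    fix \<omega>
    have "\<bar>w \<omega> * max 0 (s - X \<omega>) - w \<omega> * max 0 (t - X \<omega>)\<bar>
        = \<bar>w \<omega>\<bar> * \<bar>max 0 (s - X \<omega>) - max 0 (t - X \<omega>)\<bar>"
      by (simp add: abs_mult right_diff_distrib[symmetric])
    also have "\<dots> \<le> \<bar>w \<omega>\<bar> * \<bar>s - t\<bar>"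
      by (rule mult_left_mono) auto
    finally show "\<bar>w \<omega> * max 0 (s - X \<omega>) - w \<omega> * max 0 (t - X \<omega>)\<bar> \<le> \<bar>w \<omega>\<bar> * \<bar>s - t\<bar>" .
  qed (use w_integrable max_integrable in auto)
  finally show ?thesis by simp
qed

lemma isCont_weighted_ramp: "isCont weighted_ramp t"
proof -
  define C where "C = (\<integral>\<omega>. \<bar>w \<omega>\<bar> \<partial>M)"
  have "((\<lambda>s. C * \<bar>s - t\<bar>) \<longlongrightarrow> C * \<bar>t - t\<bar>) (at t)"
    by (intro tendsto_intros)
  then have bound: "((\<lambda>s. C * \<bar>s - t\<bar>) \<longlongrightarrow> 0) (at t)" by simp
  have "((\<lambda>s. weighted_ramp s - weighted_ramp t) \<longlongrightarrow> 0) (at t)"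
    by (rule Lim_null_comparison[OF _ bound]) (simp add: weighted_ramp_Lipschitz C_def)
  then show ?thesis
    by (simp add: isCont_def LIM_zero_iff)
qed

text \<open>Off the event \<open>X = t\<close>, the difference quotients of \<open>s \<mapsto> max 0 (s - X)\<close> at \<open>t\<close> are
  eventually equal to the indicator of \<open>X \<le> t\<close>, and they are bounded by 1: dominated convergence
  applies as soon as \<open>X\<close> has no atom at \<open>t\<close>.\<close>

lemma weighted_ramp_has_derivative:
  assumes no_atom: "AE \<omega> in M. X \<omega> \<noteq> t"
  shows "(weighted_ramp has_real_derivative weighted_cdf t) (at t)"
  unfolding has_field_derivative_iff tendsto_at_iff_sequentially comp_def
proof (intro allI impI)
  fix s :: "nat \<Rightarrow> real" assume "\<forall>n. s n \<in> UNIV - {t}" and lim: "s \<longlonglongrightarrow> t"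
  then have ne: "s n \<noteq> t" for n by auto
  let ?q = "\<lambda>n \<omega>. w \<omega> * ((max 0 (s n - X \<omega>) - max 0 (t - X \<omega>)) / (s n - t))"
  have "(\<lambda>n. integral\<^sup>L M (?q n)) \<longlonglongrightarrow> weighted_cdf t"
    unfolding weighted_cdf_def
  proof (rule integral_dominated_convergence)
    show "integrable M (\<lambda>\<omega>. \<bar>w \<omega>\<bar>)" using w_integrable by auto
    show "AE \<omega> in M. (\<lambda>n. ?q n \<omega>) \<longlonglongrightarrow> w \<omega> * indicator {\<omega>. X \<omega> \<le> t} \<omega>"
      using no_atom
    proof eventually_elim
      case (elim \<omega>)
      have "eventually (\<lambda>n. ?q n \<omega> = w \<omega> * indicator {\<omega>. X \<omega> \<le> t} \<omega>) sequentially"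
      proof (cases "X \<omega> < t")
        case True
        from order_tendstoD(1)[OF lim True] show ?thesis
          by eventually_elim (use True ne in \<open>auto simp: max_def\<close>)
      next
        case False
        with elim have gt: "t < X \<omega>" by auto
        from order_tendstoD(2)[OF lim gt] show ?thesis
          by eventually_elim (use gt in \<open>auto simp: max_def\<close>)
      qed
      then show ?case by (rule tendsto_eventually)
    qed
    fix n
    show "AE \<omega> in M. norm (?q n \<omega>) \<le> \<bar>w \<omega>\<bar>"
    proof (rule AE_I2)
      fix \<omega>
      have "\<bar>(max 0 (s n - X \<omega>) - max 0 (t - X \<omega>)) / (s n - t)\<bar> \<le> 1"
        using ne[of n] by (auto simp: abs_divide divide_le_eq_1)
      then show "norm (?q n \<omega>) \<le> \<bar>w \<omega>\<bar>"
        unfolding real_norm_def abs_mult by (rule mult_right_le_one_le[rotated 2]) auto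
    qed
    show "?q n \<in> borel_measurable M" by measurable
    show "(\<lambda>\<omega>. w \<omega> * indicator {\<omega>. X \<omega> \<le> t} \<omega>) \<in> borel_measurable M"
      using indicator_le_integrable[OF w_integrable] by auto
  qed
  moreover have "integral\<^sup>L M (?q n) = (weighted_ramp (s n) - weighted_ramp t) / (s n - t)" for n
  proof -
    have "integral\<^sup>L M (?q n)
        = (\<integral>\<omega>. (w \<omega> * max 0 (s n - X \<omega>) - w \<omega> * max 0 (t - X \<omega>)) / (s n - t) \<partial>M)"
      by (simp add: right_diff_distrib)
    also have "\<dots> = (weighted_ramp (s n) - weighted_ramp t) / (s n - t)"
      unfolding weighted_ramp_eq_max
      using Bochner_Integration.integral_diff[OF max_integrable max_integrable] by simp
    finally show ?thesis .
  qed
  ultimately show "(\<lambda>n. (weighted_ramp (s n) - weighted_ramp t) / (s n - t)) \<longlonglongrightarrow> weighted_cdf t"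
    by (simp only:)
qed

lemma isCont_weighted_cdf:
  assumes no_atom: "AE \<omega> in M. X \<omega> \<noteq> t"
  shows "isCont weighted_cdf t"
  unfolding isCont_def tendsto_at_iff_sequentially comp_def
proof (intro allI impI)
  fix s :: "nat \<Rightarrow> real" assume lim: "s \<longlonglongrightarrow> t"
  show "(\<lambda>n. weighted_cdf (s n)) \<longlonglongrightarrow> weighted_cdf t"
    unfolding weighted_cdf_def
  proof (rule integral_dominated_convergence)
    show "integrable M (\<lambda>\<omega>. \<bar>w \<omega>\<bar>)" using w_integrable by auto
    show "AE \<omega> in M. (\<lambda>n. w \<omega> * indicator {\<omega>. X \<omega> \<le> s n} \<omega>)
        \<longlonglongrightarrow> w \<omega> * indicator {\<omega>. X \<omega> \<le> t} \<omega>"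
      using no_atom
    proof eventually_elim
      case (elim \<omega>)
      have "eventually (\<lambda>n. w \<omega> * indicator {\<omega>. X \<omega> \<le> s n} \<omega>
          = w \<omega> * indicator {\<omega>. X \<omega> \<le> t} \<omega>) sequentially"
      proof (cases "X \<omega> < t")
        case True
        from order_tendstoD(1)[OF lim True] show ?thesis
          by eventually_elim (use True in auto)
      next
        case False
        with elim have gt: "t < X \<omega>" by auto
        from order_tendstoD(2)[OF lim gt] show ?thesis
          by eventually_elim (use gt in auto)
      qed
      then show ?case by (rule tendsto_eventually)
    qed
  qed (use indicator_le_integrable[OF w_integrable] in \<open>auto simp: indicator_def\<close>)
qed

lemma weighted_cdf_at_bot: "(weighted_cdf \<longlongrightarrow> 0) at_bot"
proof (rule tendsto_at_botI_sequentially)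
  fix s :: "nat \<Rightarrow> real" assume lim: "filterlim s at_bot sequentially"
  have "(\<lambda>n. weighted_cdf (s n)) \<longlonglongrightarrow> (\<integral>\<omega>. 0 \<partial>M)"
    unfolding weighted_cdf_def
  proof (rule integral_dominated_convergence)
    show "integrable M (\<lambda>\<omega>. \<bar>w \<omega>\<bar>)" using w_integrable by auto
    show "AE \<omega> in M. (\<lambda>n. w \<omega> * indicator {\<omega>. X \<omega> \<le> s n} \<omega>) \<longlonglongrightarrow> 0"
    proof (rule AE_I2)
      fix \<omega>
      from lim have "eventually (\<lambda>n. s n < X \<omega>) sequentially"
        by (simp add: filterlim_at_bot_dense)
      then have "eventually (\<lambda>n. w \<omega> * indicator {\<omega>. X \<omega> \<le> s n} \<omega> = 0) sequentially"
        by eventually_elim auto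
      then show "(\<lambda>n. w \<omega> * indicator {\<omega>. X \<omega> \<le> s n} \<omega>) \<longlonglongrightarrow> 0"
        by (rule tendsto_eventually)
    qed
  qed (use indicator_le_integrable[OF w_integrable] in \<open>auto simp: indicator_def\<close>)
  then show "(\<lambda>n. weighted_cdf (s n)) \<longlonglongrightarrow> 0" by simp
qed

lemma weighted_ramp_at_bot: "(weighted_ramp \<longlongrightarrow> 0) at_bot"
proof (rule tendsto_at_botI_sequentially)
  fix s :: "nat \<Rightarrow> real" assume lim: "filterlim s at_bot sequentially"
  \<comment> \<open>For \<open>t \<le> 0\<close> the ramp is dominated by \<open>\<bar>w X\<bar>\<close>, hence the truncation at 0.\<close>
  have "(\<lambda>n. weighted_ramp (min 0 (s n))) \<longlonglongrightarrow> (\<integral>\<omega>. 0 \<partial>M)"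
    unfolding weighted_ramp_eq_max
  proof (rule integral_dominated_convergence)
    show "integrable M (\<lambda>\<omega>. \<bar>w \<omega> * X \<omega>\<bar>)" using wX_integrable by auto
    show "AE \<omega> in M. (\<lambda>n. w \<omega> * max 0 (min 0 (s n) - X \<omega>)) \<longlonglongrightarrow> 0"
    proof (rule AE_I2)
      fix \<omega>
      from lim have "eventually (\<lambda>n. s n < X \<omega>) sequentially"
        by (simp add: filterlim_at_bot_dense)
      then have "eventually (\<lambda>n. w \<omega> * max 0 (min 0 (s n) - X \<omega>) = 0) sequentially"
        by eventually_elim auto
      then show "(\<lambda>n. w \<omega> * max 0 (min 0 (s n) - X \<omega>)) \<longlonglongrightarrow> 0"
        by (rule tendsto_eventually)
    qed
    fix n
    have "\<bar>w \<omega>\<bar> * max 0 (min 0 (s n) - X \<omega>) \<le> \<bar>w \<omega>\<bar> * \<bar>X \<omega>\<bar>" for \<omega>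
      by (rule mult_left_mono) auto
    then show "AE \<omega> in M. norm (w \<omega> * max 0 (min 0 (s n) - X \<omega>)) \<le> \<bar>w \<omega> * X \<omega>\<bar>"
      by (auto simp: abs_mult)
  qed auto
  moreover have "eventually (\<lambda>n. weighted_ramp (min 0 (s n)) = weighted_ramp (s n)) sequentially"
  proof -
    from lim have "eventually (\<lambda>n. s n < 0) sequentially"
      by (simp add: filterlim_at_bot_dense)
    then show ?thesis by eventually_elim auto
  qed
  ultimately show "(\<lambda>n. weighted_ramp (s n)) \<longlonglongrightarrow> 0"
    by (simp add: tendsto_cong)
qed

lemma cdf_eq_expectation_indicator:
  "cdf (distr M borel X) t = (\<integral>\<omega>. indicator {\<omega>. X \<omega> \<le> t} \<omega> \<partial>M)"
proof -
  have "X -` {..t} \<inter> space M = {\<omega>. X \<omega> \<le> t} \<inter> space M" by auto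
  then show ?thesis by (simp add: cdf_def2 measure_distr)
qed

lemma AE_neq_if_isCont_cdf:
  assumes "isCont (cdf (distr M borel X)) t"
  shows "AE \<omega> in M. X \<omega> \<noteq> t"
proof -
  interpret D: real_distribution "distr M borel X"
    by (rule real_distribution_distr) simp
  have "prob {\<omega> \<in> space M. X \<omega> = t} = 0"
    using assms measure_distr[OF X_meas, of "{t}"]
    by (simp add: D.isCont_cdf vimage_def Int_def conj_commute)
  then have "AE \<omega> in M. \<omega> \<notin> {\<omega> \<in> space M. X \<omega> = t}"
    by (subst (asm) prob_eq_0) measurable
  then show ?thesis by (auto elim: AE_mp)
qed

text \<open>If the weight is \<open>\<rho>(X)\<close> with \<open>\<rho>\<close> continuous at \<open>t\<close>, then over a short interval between
  \<open>t\<close> and \<open>s\<close> the weight is almost the constant \<open>\<rho> t\<close>; so the increment of the weighted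
  distribution function is \<open>\<rho> t\<close> times that of the distribution function, up to an arbitrarily
  small proportion of the latter.\<close>

lemma weighted_cdf_has_derivative:
  assumes w_eq: "w = (\<lambda>\<omega>. \<rho> (X \<omega>))" and cont: "isCont \<rho> t"
    and deriv: "(cdf (distr M borel X) has_real_derivative f') (at t)"
  shows "(weighted_cdf has_real_derivative \<rho> t * f') (at t)"
proof -
  let ?F = "cdf (distr M borel X)"
  let ?I = "\<lambda>s \<omega>. indicator {\<omega>. X \<omega> \<le> s} \<omega> :: real"
  let ?q = "\<lambda>s. (?F s - ?F t) / (s - t)"
  let ?r = "\<lambda>s. (weighted_cdf s - weighted_cdf t) / (s - t) - \<rho> t * ?q s"
  have int1: "integrable M (?I s)" for s
    using indicator_le_integrable[of "\<lambda>_. 1" s] by simp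
  have intw: "integrable M (\<lambda>\<omega>. w \<omega> * ?I s \<omega>)" for s
    by (rule indicator_le_integrable[OF w_integrable])
  have increment: "\<bar>weighted_cdf s - weighted_cdf t - \<rho> t * (?F s - ?F t)\<bar> \<le> e * \<bar>?F s - ?F t\<bar>"
    if close: "\<And>x. \<bar>x - t\<bar> \<le> \<bar>s - t\<bar> \<Longrightarrow> \<bar>\<rho> x - \<rho> t\<bar> \<le> e" for s e
  proof -
    have "\<bar>weighted_cdf s - weighted_cdf t - \<rho> t * (?F s - ?F t)\<bar>
        = \<bar>(\<integral>\<omega>. w \<omega> * ?I s \<omega> - w \<omega> * ?I t \<omega> - \<rho> t * (?I s \<omega> - ?I t \<omega>) \<partial>M)\<bar>"
      unfolding weighted_cdf_def cdf_eq_expectation_indicator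
      using int1 intw by simp
    also have "\<dots> \<le> (\<integral>\<omega>. e * (sgn (s - t) * (?I s \<omega> - ?I t \<omega>)) \<partial>M)"
    proof (rule order_trans[OF integral_abs_bound], rule integral_mono)
      fix \<omega>
      have "\<bar>w \<omega> * ?I s \<omega> - w \<omega> * ?I t \<omega> - \<rho> t * (?I s \<omega> - ?I t \<omega>)\<bar>
          = \<bar>\<rho> (X \<omega>) - \<rho> t\<bar> * \<bar>?I s \<omega> - ?I t \<omega>\<bar>"
        by (simp add: w_eq abs_mult[symmetric] algebra_simps)
      also have "\<dots> \<le> e * \<bar>?I s \<omega> - ?I t \<omega>\<bar>"
        \<comment> \<open>Where the indicators differ, \<open>X \<omega>\<close> lies between \<open>s\<close> and \<open>t\<close>.\<close>
        using close[of "X \<omega>"] by (auto simp: indicator_def)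
      also have "\<bar>?I s \<omega> - ?I t \<omega>\<bar> = sgn (s - t) * (?I s \<omega> - ?I t \<omega>)"
        by (auto simp: indicator_def sgn_if)
      finally show "\<bar>w \<omega> * ?I s \<omega> - w \<omega> * ?I t \<omega> - \<rho> t * (?I s \<omega> - ?I t \<omega>)\<bar>
          \<le> e * (sgn (s - t) * (?I s \<omega> - ?I t \<omega>))" .
    qed (use int1 intw in auto)
    also have "\<dots> = e * (sgn (s - t) * (?F s - ?F t))"
      unfolding cdf_eq_expectation_indicator using int1 by simp
    also have "\<dots> \<le> e * \<bar>?F s - ?F t\<bar>"
      using close[of t] by (intro mult_left_mono) (auto simp: sgn_if)
    finally show ?thesis .
  qed
  have q_lim: "(?q \<longlongrightarrow> f') (at t)"
    using deriv by (simp add: has_field_derivative_iff)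
  have "(?r \<longlongrightarrow> 0) (at t)"
  proof (rule tendstoI)
    fix \<epsilon> :: real assume "0 < \<epsilon>"
    \<comment> \<open>Near \<open>t\<close> the difference quotient of the distribution function is below \<open>\<bar>f'\<bar> + 1\<close>.\<close>
    define e where "e = \<epsilon> / (\<bar>f'\<bar> + 1)"
    have e: "0 < e" "e * (\<bar>f'\<bar> + 1) = \<epsilon>"
      using \<open>0 < \<epsilon>\<close> by (auto simp: e_def field_simps add_pos_nonneg)
    from cont e(1) obtain \<delta> where \<delta>: "0 < \<delta>" "\<And>x. \<bar>x - t\<bar> < \<delta> \<Longrightarrow> \<bar>\<rho> x - \<rho> t\<bar> < e"
      unfolding continuous_at_eps_delta by (auto simp: dist_real_def)
    have "eventually (\<lambda>s. \<bar>?q s\<bar> < \<bar>f'\<bar> + 1) (at t)"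
      using order_tendstoD(2)[OF tendsto_rabs[OF q_lim], of "\<bar>f'\<bar> + 1"] by simp
    moreover have "eventually (\<lambda>s. \<bar>s - t\<bar> < \<delta> \<and> s \<noteq> t) (at t)"
      using \<delta>(1) by (auto simp: eventually_at dist_real_def)
    ultimately show "eventually (\<lambda>s. dist (?r s) 0 < \<epsilon>) (at t)"
    proof eventually_elim
      case (elim s)
      have "\<bar>weighted_cdf s - weighted_cdf t - \<rho> t * (?F s - ?F t)\<bar> \<le> e * \<bar>?F s - ?F t\<bar>"
        using increment[of s e] \<delta>(2) elim(2) by (meson less_imp_le order_le_less_trans)
      then have "\<bar>weighted_cdf s - weighted_cdf t - \<rho> t * (?F s - ?F t)\<bar> / \<bar>s - t\<bar>
          \<le> e * \<bar>?F s - ?F t\<bar> / \<bar>s - t\<bar>"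
        by (rule divide_right_mono) auto
      then have "\<bar>?r s\<bar> \<le> e * \<bar>?q s\<bar>"
        by (simp add: diff_divide_distrib[symmetric])
      also have "\<dots> < e * (\<bar>f'\<bar> + 1)" by (rule mult_strict_left_mono[OF elim(1) e(1)])
      finally show ?case using e(2) by simp
    qed
  qed
  from tendsto_add[OF this tendsto_mult_left[OF q_lim, of "\<rho> t"]]
  show ?thesis by (simp add: has_field_derivative_iff)
qed

end

section \<open>Real functions with prescribed derivative\<close>

lemma constant_if_DERIV_zero_off_finite:
  fixes g :: "real \<Rightarrow> real"
  assumes "finite Y" "continuous_on UNIV g"
    and "\<And>x. x \<notin> Y \<Longrightarrow> (g has_real_derivative 0) (at x)"
  shows "\<exists>c. \<forall>x. g x = c"
proof (intro exI allI)
  fix x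
  show "g x = g 0"
  proof (rule has_derivative_zero_unique_strong_convex[where f = g and S = UNIV and K = Y and c = 0])
    fix y assume "y \<in> UNIV - Y"
    with assms(3)[of y] show "(g has_derivative (\<lambda>h. 0)) (at y within UNIV)"
      by (simp add: has_field_derivative_def lambda_zero)
  qed (use assms in auto)
qed

text \<open>The mean value theorem on \<open>[t, t + 1]\<close> gives points tending to \<open>-\<infinity>\<close> at which \<open>f\<close> equals an
  increment of \<open>F\<close>, and these increments tend to 0.\<close>

lemma derivative_limit_at_bot_eq_0:
  fixes F f :: "real \<Rightarrow> real"
  assumes F: "(F \<longlongrightarrow> l) at_bot" and F': "\<And>t. (F has_real_derivative f t) (at t)"
    and f: "(f \<longlongrightarrow> L) at_bot"
  shows "L = 0"
proof -
  have "\<exists>z. t < z \<and> z < t + 1 \<and> F (t + 1) - F t = f z" for t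
    using MVT2[of t "t + 1" F f] F' by auto
  then obtain z where z: "\<And>t. t < z t" "\<And>t. z t < t + 1" "\<And>t. F (t + 1) - F t = f (z t)"
    by metis
  have shift: "filterlim (\<lambda>t::real. t + 1) at_bot at_bot"
    by (auto simp: filterlim_at_bot eventually_at_bot_linorder le_diff_eq[symmetric])
  have "filterlim z at_bot at_bot"
    by (rule filterlim_at_bot_mono[OF shift]) (use z(2) in \<open>simp add: less_imp_le\<close>)
  then have "((\<lambda>t. f (z t)) \<longlongrightarrow> L) at_bot"
    by (rule filterlim_compose[OF f])
  moreover have "((\<lambda>t. f (z t)) \<longlongrightarrow> l - l) at_bot"
    unfolding z(3)[symmetric] by (intro tendsto_diff filterlim_compose[OF F shift] F)
  ultimately show ?thesis
    by (metis diff_self tendsto_unique trivial_limit_at_bot_linorder)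
qed

lemma eq_if_same_DERIV_and_limit_at_bot:
  fixes F G :: "real \<Rightarrow> real"
  assumes F': "\<And>t. (F has_real_derivative f t) (at t)" and G': "\<And>t. (G has_real_derivative f t) (at t)"
    and F: "(F \<longlongrightarrow> l) at_bot" and G: "(G \<longlongrightarrow> l) at_bot"
  shows "F = G"
proof -
  have "((\<lambda>t. F t - G t) has_real_derivative 0) (at t)" for t
    using DERIV_diff[OF F'[of t] G'[of t]] by simp
  then obtain c where c: "\<And>t. F t - G t = c"
    using DERIV_isconst_all by blast
  have "((\<lambda>t. F t - G t) \<longlongrightarrow> l - l) at_bot" by (intro tendsto_diff F G)
  then have "c = 0" by (simp add: c tendsto_const_iff)
  with c show ?thesis by (auto simp: fun_eq_iff)
qed

text \<open>Being \<open>C\<^sup>1\<close> is a local property, and the components of an open set of reals are open.\<close>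

lemma C1_on_components_imp_continuous_deriv:
  fixes p :: "real \<Rightarrow> real"
  assumes "open S" and C1: "\<And>I. I \<in> components S \<Longrightarrow> p C1_differentiable_on I" and x: "x \<in> S"
  shows "(p has_real_derivative deriv p x) (at x)" and "isCont (deriv p) x"
proof -
  define I where "I = connected_component_set S x"
  have I: "I \<in> components S" "x \<in> I" "open I"
    using x \<open>open S\<close> unfolding I_def
    by (auto simp: components_def connected_component_refl open_connected_component)
  from C1[OF I(1)] obtain D where D: "\<And>y. y \<in> I \<Longrightarrow> (p has_real_derivative D y) (at y)"
      and contD: "continuous_on I D"
    unfolding C1_differentiable_on_def has_real_derivative_iff_has_vector_derivative by auto
  have D_eq: "deriv p y = D y" if "y \<in> I" for y
    using D[OF that] by (rule DERIV_imp_deriv)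
  show "(p has_real_derivative deriv p x) (at x)"
    using D[OF I(2)] D_eq[OF I(2)] by simp
  have "continuous_on I (deriv p)"
    using contD D_eq by (simp cong: continuous_on_cong)
  then show "isCont (deriv p) x"
    using I continuous_on_eq_continuous_at by blast
qed

section \<open>Continuous densities\<close>

lemma continuous_density_cdf:
  fixes p :: "real \<Rightarrow> real"
  assumes cont: "continuous_on UNIV p" and nonneg: "\<And>x. 0 \<le> p x"
    and int: "integrable lborel p" "(\<integral>x. p x \<partial>lborel) = 1"
  shows "real_distribution (density lborel p)"
    and "(cdf (density lborel p) has_real_derivative p t) (at t)"
proof -
  let ?Q = "density lborel p"
  have [measurable]: "p \<in> borel_measurable borel" using int(1) by auto
  have meas: "emeasure ?Q A = ennreal (LBINT x:A. p x)" if "A \<in> sets borel" for A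
  proof -
    have "emeasure ?Q A = (\<integral>\<^sup>+x. ennreal (indicator A x *\<^sub>R p x) \<partial>lborel)"
      using that by (auto simp: emeasure_density intro!: nn_integral_cong split: split_indicator)
    also have "\<dots> = ennreal (LBINT x:A. p x)"
      unfolding set_lebesgue_integral_def
      using that int(1) nonneg
      by (intro nn_integral_eq_integral integrable_mult_indicator) auto
    finally show ?thesis .
  qed
  interpret Q: prob_space ?Q
    by (rule prob_spaceI) (use meas[of UNIV] int(2) in \<open>simp add: set_lebesgue_integral_def\<close>)
  show "real_distribution ?Q" by unfold_locales auto
  then interpret Q: real_distribution ?Q .
  have int_on: "set_integrable lborel A p" if "A \<in> sets borel" for A
    unfolding set_integrable_def using that int(1) by (intro integrable_mult_indicator) auto
  have cdf_eq: "cdf ?Q u = (LBINT x:{..u}. p x)" for u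
    using nonneg unfolding cdf_def2 measure_def meas[OF atMost_borel]
    by (simp add: set_lebesgue_integral_def)
  \<comment> \<open>Differentiability at \<open>t\<close> is local, so the part of the integral below \<open>t - 1\<close> is split off as a
      constant and the fundamental theorem is applied on a compact interval around \<open>t\<close>.\<close>
  define a where "a = t - 1"
  have cdf_split: "cdf ?Q u = cdf ?Q a + integral {a..u} p" if "a \<le> u" for u
  proof -
    have "{..u} = {..a} \<union> {a<..u}" using that by auto
    then have "cdf ?Q u = cdf ?Q a + (LBINT x:{a<..u}. p x)"
      unfolding cdf_eq by (auto simp: int_on intro!: set_integral_Un)
    also have "(LBINT x:{a<..u}. p x) = (LBINT x:{a..u}. p x)"
      using that int_on by (simp add: interval_integral_Ioc[symmetric] interval_integral_Icc[symmetric])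
    also have "\<dots> = integral {a..u} p"
      by (rule set_borel_integral_eq_integral) (simp add: int_on)
    finally show ?thesis .
  qed
  have "((\<lambda>u. integral {a..u} p) has_vector_derivative p t) (at t within {a..t+1})"
    by (rule integral_has_vector_derivative[OF continuous_on_subset[OF cont]]) (auto simp: a_def)
  then have "((\<lambda>u. integral {a..u} p) has_real_derivative p t) (at t)"
    using at_within_Icc_at[of a t "t + 1"]
    by (simp add: a_def has_real_derivative_iff_has_vector_derivative)
  from DERIV_add[OF DERIV_const this, of "cdf ?Q a"]
  have "((\<lambda>u. cdf ?Q a + integral {a..u} p) has_real_derivative p t) (at t)"
    by simp
  then show "(cdf ?Q has_real_derivative p t) (at t)"
  proof (rule has_field_derivative_transform_within_open[of _ _ _ "{a<..}"])
    fix u assume "u \<in> {a<..}"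
    then show "cdf ?Q a + integral {a..u} p = cdf ?Q u"
      by (intro cdf_split[symmetric]) simp
  qed (auto simp: a_def)
qed

theorem theorem4p1:
  fixes M :: "'a measure" and X :: "'a \<Rightarrow> real"
    and p P :: "real \<Rightarrow> real" and Y S :: "real set"
  assumes "prob_space M"
    and p_nonneg: "\<And>x. 0 \<le> p x"
    and p_density: "integrable lborel p" "(\<integral>x. p x \<partial>lborel) = 1"
    and p_support: "closure {x. p x \<noteq> 0} = UNIV"
    and P_def: "P = (\<lambda>x. LBINT s:{..x}. p s)"
    and Y_finite: "finite Y"
    and S_def: "S = UNIV - Y"
    and p_cont_pos: "continuous_on UNIV p" "\<And>x. 0 < p x"
    and p_C1: "\<And>I. I \<in> components S \<Longrightarrow> p C1_differentiable_on I"
    and p_bounded: "bdd_above ((\<lambda>x. \<bar>deriv p x * min (P x) (1 - P x) / (p x)\<^sup>2\<bar>) ` S)"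
    and p_integrable: "set_integrable lborel S (\<lambda>x. (1 + \<bar>x\<bar>) * \<bar>deriv p x\<bar>)"
    and X_measurable: "X \<in> borel_measurable M"
    and X_in_S: "\<P>(\<omega> in M. X \<omega> \<in> S) = 1"
    and X_integrable1: "integrable M (\<lambda>\<omega>. \<bar>deriv p (X \<omega>) / p (X \<omega>)\<bar>)"
    and X_integrable2: "integrable M (\<lambda>\<omega>. \<bar>deriv p (X \<omega>) / p (X \<omega>) * X \<omega>\<bar>)"
  shows "distributed M lborel X (\<lambda>x. ennreal (p x)) \<longleftrightarrow>
    (\<forall>t. cdf (distr M borel X) t =
      (\<integral>\<omega>. deriv p (X \<omega>) / p (X \<omega>) * (t - X \<omega>) * indicator {\<omega>. X \<omega> \<le> t} \<omega> \<partial>M))"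
proof -
  let ?D = "distr M borel X" and ?Q = "density lborel p"
  let ?F = "cdf ?D"
  define \<rho> where "\<rho> x = deriv p x / p x" for x
  define w where "w \<omega> = \<rho> (X \<omega>)" for \<omega>
  have open_S: "open S"
    unfolding S_def using finite_imp_closed[OF Y_finite] by (simp add: open_Diff)
  have p': "(p has_real_derivative deriv p x) (at x)" and p'_cont: "isCont (deriv p) x"
    if "x \<notin> Y" for x
    using C1_on_components_imp_continuous_deriv[OF open_S p_C1, of x] that by (auto simp: S_def)
  have p_cont: "isCont p x" for x
    using p_cont_pos(1) by (simp add: continuous_on_eq_continuous_at)
  have \<rho>_cont: "isCont \<rho> x" if "x \<notin> Y" for x
    unfolding \<rho>_def using p'_cont[OF that] p_cont p_cont_pos(2)[of x] by (intro continuous_intros) auto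
  \<comment> \<open>The hypotheses give integrability of absolute values only; measurability of \<open>\<rho>(X)\<close> itself
      comes from continuity of \<open>\<rho>\<close> off a finite set.\<close>
  have \<rho>_meas [measurable]: "\<rho> \<in> borel_measurable borel"
    by (rule borel_measurable_continuous_countable_exceptions[of Y])
       (use Y_finite \<rho>_cont in \<open>auto intro: countable_finite continuous_at_imp_continuous_on\<close>)
  interpret prob_space M by fact
  note X_measurable [measurable]
  interpret weighted_random_variable M X w
  proof
    show "integrable M w"
      by (rule integrable_abs_cancel) (use X_integrable1 in \<open>auto simp: w_def[abs_def] \<rho>_def[symmetric]\<close>)
    show "integrable M (\<lambda>\<omega>. w \<omega> * X \<omega>)"
      by (rule integrable_abs_cancel) (use X_integrable2 in \<open>auto simp: w_def[abs_def] \<rho>_def[symmetric]\<close>)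
  qed fact
  have w_eq: "w = (\<lambda>\<omega>. \<rho> (X \<omega>))" by (simp add: w_def[abs_def])
  interpret D: real_distribution ?D
    by (rule real_distribution_distr) simp
  interpret Q: real_distribution ?Q
    by (rule continuous_density_cdf) (use p_cont_pos p_nonneg p_density in auto)
  have Q': "(cdf ?Q has_real_derivative p t) (at t)" for t
    by (rule continuous_density_cdf) (use p_cont_pos p_nonneg p_density in auto)

  have "distributed M lborel X (\<lambda>x. ennreal (p x)) \<longleftrightarrow> ?D = ?Q"
  proof -
    have "distr M lborel X = ?D" by (rule distr_cong) auto
    moreover have "p \<in> borel_measurable borel" using p_density(1) by auto
    ultimately show ?thesis by (simp add: distributed_def)
  qed
  also have "\<dots> \<longleftrightarrow> ?F = cdf ?Q"
    using cdf_unique[of ?D ?Q] D.real_distribution_axioms Q.real_distribution_axioms by auto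
  also have "\<dots> \<longleftrightarrow> ?F = weighted_ramp"
  proof
    assume F: "?F = cdf ?Q"
    then have F': "(?F has_real_derivative p t) (at t)" for t using Q' by simp
    have no_atom: "AE \<omega> in M. X \<omega> \<noteq> t" for t
      using DERIV_isCont[OF F'] by (rule AE_neq_if_isCont_cdf)
    have "\<exists>c. \<forall>t. weighted_cdf t - p t = c"
    proof (rule constant_if_DERIV_zero_off_finite[OF Y_finite])
      show "continuous_on UNIV (\<lambda>t. weighted_cdf t - p t)"
        using isCont_weighted_cdf[OF no_atom] p_cont
        by (intro continuous_at_imp_continuous_on ballI isCont_diff)
      show "((\<lambda>t. weighted_cdf t - p t) has_real_derivative 0) (at t)" if "t \<notin> Y" for t
        using DERIV_diff[OF weighted_cdf_has_derivative[OF w_eq \<rho>_cont[OF that] F'] p'[OF that]]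
          p_cont_pos(2)[of t]
        by (simp add: \<rho>_def)
    qed
    then obtain c where c: "\<And>t. p t = weighted_cdf t - c"
      by (metis add_diff_cancel_left' diff_add_cancel)
    have "(p \<longlongrightarrow> 0 - c) at_bot"
      unfolding c by (intro tendsto_diff weighted_cdf_at_bot tendsto_const)
    then have "0 - c = 0"
      by (rule derivative_limit_at_bot_eq_0[OF D.cdf_lim_at_bot F'])
    then have "weighted_cdf t = p t" for t by (simp add: c)
    then have "(weighted_ramp has_real_derivative p t) (at t)" for t
      using weighted_ramp_has_derivative[OF no_atom, of t] by simp
    then show "?F = weighted_ramp"
      by (rule eq_if_same_DERIV_and_limit_at_bot[OF F' _ D.cdf_lim_at_bot weighted_ramp_at_bot])
  next
    assume F: "?F = weighted_ramp"
    have no_atom: "AE \<omega> in M. X \<omega> \<noteq> t" for t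
      by (rule AE_neq_if_isCont_cdf) (simp add: F isCont_weighted_ramp)
    have F': "(?F has_real_derivative weighted_cdf t) (at t)" for t
      unfolding F by (rule weighted_ramp_has_derivative[OF no_atom])
    have "\<exists>c. \<forall>t. weighted_cdf t / p t = c"
    proof (rule constant_if_DERIV_zero_off_finite[OF Y_finite])
      show "continuous_on UNIV (\<lambda>t. weighted_cdf t / p t)"
        using isCont_weighted_cdf[OF no_atom] p_cont p_cont_pos(2)
        by (intro continuous_at_imp_continuous_on ballI isCont_divide) (auto simp: less_imp_neq[symmetric])
      show "((\<lambda>t. weighted_cdf t / p t) has_real_derivative 0) (at t)" if "t \<notin> Y" for t
        using DERIV_divide[OF weighted_cdf_has_derivative[OF w_eq \<rho>_cont[OF that] F'] p'[OF that]]
          p_cont_pos(2)[of t]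
        by (simp add: \<rho>_def)
    qed
    then obtain c where "\<And>t. weighted_cdf t / p t = c" by blast
    then have c: "weighted_cdf t = c * p t" for t
      using p_cont_pos(2)[of t] by (metis less_irrefl nonzero_divide_eq_eq)
    have cQ': "((\<lambda>t. c * cdf ?Q t) has_real_derivative weighted_cdf t) (at t)" for t
      unfolding c by (rule DERIV_cmult[OF Q'])
    have "?F = (\<lambda>t. c * cdf ?Q t)"
      by (rule eq_if_same_DERIV_and_limit_at_bot[OF F' cQ' D.cdf_lim_at_bot])
         (use tendsto_mult_left[OF Q.cdf_lim_at_bot, of c] in simp)
    moreover from this have "c = 1"
      using tendsto_unique[OF _ D.cdf_lim_at_top_prob, of "c * 1"]
        tendsto_mult_left[OF Q.cdf_lim_at_top_prob, of c] by simp
    ultimately show "?F = cdf ?Q" by simp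
  qed
  also have "\<dots> \<longleftrightarrow> (\<forall>t. ?F t = (\<integral>\<omega>. deriv p (X \<omega>) / p (X \<omega>) * (t - X \<omega>)
      * indicator {\<omega>. X \<omega> \<le> t} \<omega> \<partial>M))"
    by (simp add: fun_eq_iff weighted_ramp_def w_def \<rho>_def)
  finally show ?thesis .
qed

end
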